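(* Let $\mathcal{A}$ be an $\mathbf{R}_0$-tensor of order $m\ge 2$ and dimension $n$ with $\deg(\mathcal{A})\neq 0$. Then $\mathcal{A}$ has the strong $\mathbf{Q}$-property.
   Context: A (real) tensor of order $m$ and dimension $n$ is an array $\mathcal{A}=[a_{i_1i_2\cdots i_m}]$ of real numbers, $i_1,\dots,i_m\in\{1,\dots,n\}$. It defines the polynomial map $F(x):=\mathcal{A}x^{m-1}$ on $\mathbb{R}^n$, homogeneous of degree $m-1$, with components $(\mathcal{A}x^{m-1})_i=\sum_{i_2,\dots,i_m=1}^n a_{ii_2\cdots i_m}x_{i_2}\cdots x_{i_m}$. For a polynomial map $f:\mathbb{R}^n\to\mathbb{R}^n$ and $q\in\mathbb{R}^n$, $\mathrm{PCP}(f,q)$ is the problem of finding $x$ with $x\ge 0$, $f(x)+q\ge 0$ (componentwise), $\langle x,f(x)+q\rangle=0$; $\mathrm{SOL}(f,q)$ is its solution set, and $\mathrm{SOL}(\mathcal{A},q):=\mathrm{SOL}(F,q)$. $\mathcal{A}$ is an $\mathbf{R}_0$-tensor (has the $\mathbf{R}_0$-property) if $\mathrm{SOL}(\mathcal{A},0)=\{0\}$. In that case $\widehat{F}(x):=\min\{x,F(x)\}$ (componentwise minimum) has $0$ as its only zero, and $\deg(\mathcal{A}):=\deg(\widehat{F},0)$, the local (topological) degree at the origin, i.e. the Brouwer degree of $\widehat{F}$ over any bounded open set containing $0$ with respect to the value $0$. $\mathcal{A}$ has the strong $\mathbf{Q}$-property if $\mathrm{PCP}(F+P,q)$ has a nonempty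 compact solution set for all $q\in\mathbb{R}^n$ and all polynomial maps $P:\mathbb{R}^n\to\mathbb{R}^n$ of degree less than $m-1$; equivalently, $\mathrm{PCP}(f,q)$ has a nonempty compact solution set for all $q$ and all polynomial maps $f$ whose leading term (highest-degree homogeneous part) is $\mathcal{A}x^{m-1}$. *)

theory Defs
  imports "HOL-Analysis.Analysis" "HOL-Homology.Homology"
begin

section \<open>Tensors and polynomial complementarity problems\<close>

text \<open>A tensor of order \<open>m\<close> and dimension \<open>CARD('n)\<close> is given by its entries
  \<open>A [i\<^sub>1, \<dots>, i\<^sub>m]\<close>. Its values on lists of length other than \<open>m\<close> are never used.\<close>

type_synonym 'n tensor = "'n list \<Rightarrow> real"

definition tensor_map :: "nat \<Rightarrow> 'n::finite tensor \<Rightarrow> real^'n \<Rightarrow> real^'n" where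
  "tensor_map m A x =
     (\<chi> i. \<Sum>js | length js = m - 1. A (i # js) * prod_list (map (\<lambda>j. x $ j) js))"

text \<open>The order on \<open>real^'n\<close> is the componentwise one.\<close>

definition SOL :: "(real^'n::finite \<Rightarrow> real^'n) \<Rightarrow> real^'n \<Rightarrow> (real^'n) set" where
  "SOL f q = {x. 0 \<le> x \<and> 0 \<le> f x + q \<and> x \<bullet> (f x + q) = 0}"

definition R0_tensor :: "nat \<Rightarrow> 'n::finite tensor \<Rightarrow> bool" where
  "R0_tensor m A \<longleftrightarrow> SOL (tensor_map m A) 0 = {0}"

text \<open>Polynomial maps of total degree less than \<open>k\<close> (the zero map included), as linear
  combinations with vector coefficients of the monomials \<open>x\<^sup>\<alpha>\<close> with \<open>\<bar>\<alpha>\<bar> < k\<close>.\<close>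

definition polynomial_map_degree_less ::
    "nat \<Rightarrow> (real^'n::finite \<Rightarrow> real^'n) \<Rightarrow> bool" where
  "polynomial_map_degree_less k P \<longleftrightarrow>
     (\<exists>c :: ('n \<Rightarrow> nat) \<Rightarrow> real^'n.
        \<forall>x. P x = (\<Sum>\<alpha> | sum \<alpha> UNIV < k. (\<Prod>i\<in>UNIV. (x $ i) ^ \<alpha> i) *\<^sub>R c \<alpha>))"

lemma finite_multi_indices: "finite {\<alpha> :: 'n::finite \<Rightarrow> nat. sum \<alpha> UNIV < k}"
proof (rule finite_subset)
  have "\<alpha> i < k" if "sum \<alpha> UNIV < k" for \<alpha> :: "'n \<Rightarrow> nat" and i
    using member_le_sum [of i UNIV \<alpha>] that by simp
  then show "{\<alpha> :: 'n \<Rightarrow> nat. sum \<alpha> UNIV < k} \<subseteq> (\<Pi>\<^sub>E i\<in>UNIV. {..<k})"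
    by auto
  show "finite (\<Pi>\<^sub>E i\<in>(UNIV :: 'n set). {..<k})"
    by (rule finite_PiE) auto
qed

definition strong_Q_property :: "nat \<Rightarrow> 'n::finite tensor \<Rightarrow> bool" where
  "strong_Q_property m A \<longleftrightarrow>
     (\<forall>P q. polynomial_map_degree_less (m - 1) P \<longrightarrow>
        SOL (\<lambda>x. tensor_map m A x + P x) q \<noteq> {} \<and>
        compact (SOL (\<lambda>x. tensor_map m A x + P x) q))"


section \<open>The Brouwer degree\<close>

text \<open>The Brouwer degree of \<open>f\<close> over a bounded open set \<open>U\<close> with respect to the value \<open>p\<close>, for
  \<open>f\<close> continuous on \<open>closure U\<close> and \<open>p \<notin> f ` frontier U\<close>; see Dold, Lectures on Algebraic
  Topology, IV.5 and VIII.4. Let \<open>n\<close> be the dimension and \<open>K = {x \<in> U. f x = p}\<close>, a compact set.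
  For a ball \<open>B\<close> containing \<open>K\<close> and \<open>p\<close>, a generator \<open>g\<close> of the infinite cyclic
  group \<open>H\<^sub>n(\<real>\<^sup>n, \<real>\<^sup>n - B)\<close> (an orientation) restricts to a class \<open>g\<^sub>K\<close> in
  \<open>H\<^sub>n(\<real>\<^sup>n, \<real>\<^sup>n - K)\<close> and to a generator \<open>g\<^sub>p\<close> of \<open>H\<^sub>n(\<real>\<^sup>n, \<real>\<^sup>n - {p})\<close>. By excision
  \<open>g\<^sub>K\<close> is the image of a unique class \<open>c\<close> in \<open>H\<^sub>n(U, U - K)\<close>, and the degree \<open>d\<close> is
  determined by \<open>f\<^sub>*(c) = d \<cdot> g\<^sub>p\<close>. Reversing the orientation \<open>g\<close> reverses \<open>c\<close> too, so \<open>d\<close>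
  does not depend on the choices made. Homology groups are written multiplicatively below.\<close>

definition brouwer_degree ::
    "(real^'n::finite \<Rightarrow> real^'n) \<Rightarrow> (real^'n) set \<Rightarrow> real^'n \<Rightarrow> int" where
  "brouwer_degree f U p =
    (let n = int CARD('n);
         K = {x \<in> U. f x = p}
     in THE d. \<exists>r g c.
          K \<union> {p} \<subseteq> cball 0 r \<and>
          g \<in> carrier (relative_homology_group n euclidean (- cball 0 r)) \<and>
          subgroup_generated (relative_homology_group n euclidean (- cball 0 r)) {g} =
            relative_homology_group n euclidean (- cball 0 r) \<and>
          c \<in> carrier (relative_homology_group n (top_of_set U) (U - K)) \<and>
          hom_induced n (top_of_set U) (U - K) euclidean (- K) id c =
            hom_induced n euclidean (- cball 0 r) euclidean (- K) id g \<and>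
          hom_induced n (top_of_set U) (U - K) euclidean (- {p}) f c =
            (hom_induced n euclidean (- cball 0 r) euclidean (- {p}) id g)
              [^]\<^bsub>relative_homology_group n euclidean (- {p})\<^esub> d)"

text \<open>The local degree of \<open>f\<close> at a point \<open>a\<close> that is isolated in the fibre of \<open>f\<close> through \<open>a\<close>:
  the common value of the degrees over all bounded open neighbourhoods of \<open>a\<close> whose closure
  meets the fibre in \<open>a\<close> only.\<close>

definition local_degree :: "(real^'n::finite \<Rightarrow> real^'n) \<Rightarrow> real^'n \<Rightarrow> int" where
  "local_degree f a =
    (THE d. \<forall>U. open U \<and> bounded U \<and> a \<in> U \<and> (\<forall>x\<in>closure U. f x = f a \<longrightarrow> x = a)
                \<longrightarrow> brouwer_degree f U (f a) = d)"

definition tensor_min_map :: "nat \<Rightarrow> 'n::finite tensor \<Rightarrow> real^'n \<Rightarrow> real^'n" where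
  "tensor_min_map m A x = (\<chi> i. min (x $ i) (tensor_map m A x $ i))"

definition tensor_degree :: "nat \<Rightarrow> 'n::finite tensor \<Rightarrow> int" where
  "tensor_degree m A = local_degree (tensor_min_map m A) 0"

end

theory Submission
  imports Defs
begin

text \<open>Let \<open>F x = A x\<^sup>m\<^sup>-\<^sup>1\<close> and \<open>Q = P + q\<close>. Zeros of \<open>min {x, F x + t Q x}\<close> are solutions of a
  complementarity problem, and by the \<open>R\<^sub>0\<close>-property they are bounded uniformly in \<open>t \<in> [0,1]\<close>, since
  \<open>Q\<close> is of lower order than \<open>F\<close>. This gives compactness. If there were no zero for \<open>t = 1\<close>, then
  \<open>min {x, F x}\<close> would be homotopic, as a self-map of \<open>\<real>\<^sup>n - {0}\<close>, to a map that extends to \<open>\<real>\<^sup>n\<close>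
  without zeros. It would then induce the trivial map on \<open>H\<^sub>n(\<real>\<^sup>n, \<real>\<^sup>n - {0})\<close>. Hence \<open>0\<close> would be the
  only integer with the defining property of the degree, which is therefore \<open>0\<close>; that the description is
  satisfied by exactly one integer matters, as \<open>THE\<close> might otherwise return a nonzero value.\<close>

section \<open>Homology of punctured Euclidean space\<close>

text \<open>For \<open>R \<ge> 0\<close> this map moves a nonzero point outward along its ray by the
  distance \<open>R\<close>, which clears the ball of that radius.\<close>

lemma continuous_on_push:
  fixes S :: "'a::real_normed_vector set"
  assumes "0 \<notin> S"
  shows "continuous_on S (\<lambda>x. (1 + R / norm x) *\<^sub>R x)"
  using assms by (auto intro!: continuous_intros)

lemma norm_push:
  fixes x :: "'a::real_normed_vector"
  assumes "x \<noteq> 0" "0 \<le> R"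
  shows "norm ((1 + R / norm x) *\<^sub>R x) = norm x + R"
proof -
  have "norm ((1 + R / norm x) *\<^sub>R x) = (1 + R / norm x) * norm x"
    using assms by simp
  also have "\<dots> = norm x + R"
    using assms by (simp add: field_simps)
  finally show ?thesis .
qed

text \<open>The straight-line homotopy only rescales \<open>x\<close> by factors at least 1. Both
  the punctured space and the complement of a ball are closed under this.\<close>

lemma homotopic_push_id:
  fixes S :: "'a::real_normed_vector set"
  assumes "0 \<le> R" "0 \<notin> S" and scale: "\<And>x t. x \<in> S \<Longrightarrow> 1 \<le> t \<Longrightarrow> t *\<^sub>R x \<in> S"
  shows "homotopic_with_canon (\<lambda>_. True) S S (\<lambda>x. (1 + R / norm x) *\<^sub>R x) id"
proof (rule homotopic_with_linear)
  fix x assume x: "x \<in> S"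
  show "closed_segment ((1 + R / norm x) *\<^sub>R x) (id x) \<subseteq> S"
  proof
    fix y assume "y \<in> closed_segment ((1 + R / norm x) *\<^sub>R x) (id x)"
    then obtain u where u: "0 \<le> u" "u \<le> 1"
      and y: "y = (1 - u) *\<^sub>R ((1 + R / norm x) *\<^sub>R x) + u *\<^sub>R x"
      by (auto simp: in_segment)
    have "y = (1 + (1 - u) * (R / norm x)) *\<^sub>R x"
      unfolding y by (simp add: algebra_simps)
    moreover have "0 \<le> (1 - u) * (R / norm x)"
      using u \<open>0 \<le> R\<close> by simp
    ultimately show "y \<in> S"
      using scale[OF x, of "1 + (1 - u) * (R / norm x)"] by simp
  qed
qed (use continuous_on_push[OF \<open>0 \<notin> S\<close>] in auto)

text \<open>The inclusion \<open>id\<close> and \<open>push\<close> are inverse up to homotopy. The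
  four claims match the premises of homotopy invariance for reduced homology.\<close>

lemma homotopy_equivalence_complement_cball:
  fixes r :: real
  defines "push \<equiv> \<lambda>x::'a::real_normed_vector. (1 + r / norm x) *\<^sub>R x"
  assumes "0 \<le> r"
  shows "continuous_map (top_of_set (- cball (0::'a) r)) (top_of_set (- {0})) id"
    and "continuous_map (top_of_set (- {0})) (top_of_set (- cball 0 r)) push"
    and "homotopic_with_canon (\<lambda>_. True) (- cball 0 r) (- cball 0 r) (push \<circ> id) id"
    and "homotopic_with_canon (\<lambda>_. True) (- {0}) (- {0}) (id \<circ> push) id"
proof -
  show "continuous_map (top_of_set (- cball (0::'a) r)) (top_of_set (- {0})) id"
    using \<open>0 \<le> r\<close> by (auto simp: id_def)
  show "continuous_map (top_of_set (- {0})) (top_of_set (- cball 0 r)) push"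
    using \<open>0 \<le> r\<close> continuous_on_push[of "- {0::'a}" r]
    by (auto simp: push_def norm_push simp del: norm_scaleR)
  have "t *\<^sub>R x \<in> - cball 0 r" if "x \<in> - cball 0 r" "1 \<le> t" for x :: 'a and t :: real
    using that mult_right_mono[of 1 t "norm x"] by auto
  then show "homotopic_with_canon (\<lambda>_. True) (- cball 0 r) (- cball 0 r) (push \<circ> id) id"
    using \<open>0 \<le> r\<close> unfolding push_def comp_id by (intro homotopic_push_id) auto
  show "homotopic_with_canon (\<lambda>_. True) (- {0}) (- {0}) (id \<circ> push) id"
    using \<open>0 \<le> r\<close> unfolding push_def id_comp by (intro homotopic_push_id) auto
qed

section \<open>Homology of complements of balls\<close>

text \<open>The punctured space is homotopy equivalent to the unit sphere. Reduced homology covers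
  dimension 1 too, where the sphere has two points.\<close>

lemma reduced_homology_group_punctured:
  "reduced_homology_group (int DIM('a) - 1) (top_of_set (- {0::'a::euclidean_space})) \<cong> integer_group"
proof -
  have int: "interior (cball (0::'a) 1) \<noteq> {}"
    by simp
  have "rel_frontier (cball (0::'a) 1) homotopy_eqv (affine hull (cball 0 1) - {0::'a})"
    by (rule homotopy_eqv_rel_frontier_punctured_affine_hull)
      (simp_all add: rel_interior_nonempty_interior[OF int])
  then have 1: "sphere (0::'a) 1 homotopy_eqv (- {0::'a})"
    by (simp add: affine_hull_nonempty_interior[OF int] rel_frontier_nonempty_interior[OF int]
        Compl_eq_Diff_UNIV)
  obtain f :: "(nat \<Rightarrow> real) \<Rightarrow> 'a" and g where
    "homeomorphic_maps (nsphere (DIM('a) - 1)) (top_of_set (sphere 0 1 \<inter> span Basis)) f g"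
    by (rule homeomorphic_maps_nsphere_euclidean_sphere[OF independent_Basis orthogonal_Basis])
      auto
  then have "nsphere (DIM('a) - 1) homeomorphic_space top_of_set (sphere (0::'a) 1)"
    by (auto simp: homeomorphic_space_def)
  then have "nsphere (DIM('a) - 1) homotopy_equivalent_space top_of_set (- {0::'a})"
    using 1 homeomorphic_imp_homotopy_equivalent_space homotopy_eqv_trans by blast
  then have "reduced_homology_group p (nsphere (DIM('a) - 1))
      \<cong> reduced_homology_group p (top_of_set (- {0::'a}))" for p
    by (rule homotopy_equivalent_space_imp_isomorphic_reduced_homology_groups)
  then have "reduced_homology_group p (top_of_set (- {0::'a}))
      \<cong> reduced_homology_group p (nsphere (DIM('a) - 1))" for p
    by (simp add: group.iso_sym)
  \<comment> \<open>The natural subtraction does not truncate, as the dimension is positive.\<close>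
  moreover have "int DIM('a) - 1 = int (DIM('a) - 1)"
    by (simp add: of_nat_diff Suc_leI)
  ultimately show ?thesis
    using iso_trans reduced_homology_group_nsphere(1) by metis
qed

lemma iso_reduced_homology_complement_cball:
  assumes "0 \<le> r"
  shows "hom_induced p (top_of_set (- cball (0::'a::real_normed_vector) r)) {} (top_of_set (- {0})) {} id
    \<in> iso (reduced_homology_group p (top_of_set (- cball 0 r)))
          (reduced_homology_group p (top_of_set (- {0})))"
  using homotopy_equivalence_complement_cball[OF assms, where 'a='a]
  by (rule homotopy_equivalence_reduced_homology_group_isomorphism)

lemma complement_cball_nonempty: "- cball (0::'a::euclidean_space) r \<noteq> {}"
proof
  assume "- cball (0::'a) r = {}"
  then have "cball (0::'a) r = UNIV" by blast
  then show False
    using bounded_cball[of "0::'a" r] not_bounded_UNIV by metis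
qed

text \<open>Euclidean space is contractible, so its reduced homology drops out of the long exact
  sequence of the pair.\<close>

lemma iso_hom_boundary_complement_cball:
  "hom_boundary p euclidean (- cball 0 r)
    \<in> iso (relative_homology_group p euclidean (- cball (0::'a::euclidean_space) r))
          (reduced_homology_group (p - 1) (top_of_set (- cball 0 r)))"
proof (rule iso_relative_homology_of_contractible)
  show "contractible_space (euclidean :: 'a topology)"
    using contractible_space_top_of_set[of "UNIV :: 'a set"] by simp
qed (use complement_cball_nonempty[of r, where 'a='a] in simp)

lemma iso_hom_boundary_punctured:
  "hom_boundary p euclidean (- {0})
    \<in> iso (relative_homology_group p euclidean (- {0::'a::euclidean_space}))
          (reduced_homology_group (p - 1) (top_of_set (- {0})))"
  using iso_hom_boundary_complement_cball[of p 0] by simp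

lemma relative_homology_group_complement_cball:
  assumes "0 \<le> r"
  shows "relative_homology_group (int DIM('a)) euclidean (- cball (0::'a::euclidean_space) r)
    \<cong> integer_group"
  using iso_hom_boundary_complement_cball iso_reduced_homology_complement_cball[OF assms]
    reduced_homology_group_punctured iso_trans is_isoI by meson

text \<open>By naturality, this map followed by \<open>hom_boundary\<close> is a composite of two
  isomorphisms. It lets relations at the origin be pulled back to the orientation class.\<close>

lemma inj_on_hom_induced_complement_cball:
  assumes "0 \<le> r"
  shows "inj_on (hom_induced p euclidean (- cball (0::'a::euclidean_space) r) euclidean (- {0}) id)
    (carrier (relative_homology_group p euclidean (- cball 0 r)))" (is "inj_on ?j ?C")
proof -
  have "hom_boundary p euclidean (- {0}) \<circ> ?j
    = hom_induced (p - 1) (top_of_set (- cball 0 r)) {} (top_of_set (- {0})) {} id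
      \<circ> hom_boundary p euclidean (- cball 0 r)"
    using assms by (intro naturality_hom_induced) auto
  moreover have "inj_on \<dots> ?C"
    using iso_hom_boundary_complement_cball[of p r, where 'a='a]
      iso_reduced_homology_complement_cball[OF assms, of "p - 1", where 'a='a]
    by (intro comp_inj_on) (auto simp: iso_def bij_betw_def)
  ultimately have "inj_on (hom_boundary p euclidean (- {0}) \<circ> ?j) ?C"
    by simp
  then show ?thesis
    by (rule inj_on_imageI2)
qed

lemma iso_preimage:
  assumes "h \<in> iso G H" "y \<in> carrier H"
  obtains x where "x \<in> carrier G" "h x = y"
  using assms by (force simp: iso_def bij_betw_def)

text \<open>This makes the exponent in the definition of the degree unique: a generator has nonzero
  image in the integers, hence infinite order.\<close>

lemma generator_int_pow_eq_one:
  assumes "group G" "G \<cong> integer_group" "g \<in> carrier G" "subgroup_generated G {g} = G"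
    and "g [^]\<^bsub>G\<^esub> (d::int) = \<one>\<^bsub>G\<^esub>"
  shows "d = 0"
proof -
  interpret group G by fact
  obtain h where h: "h \<in> iso G integer_group"
    using assms(2) by (auto simp: is_iso_def)
  then interpret h: group_hom G integer_group h
    by (auto simp: group_hom_def group_hom_axioms_def iso_def)
  have "d * h g = h (g [^]\<^bsub>G\<^esub> d)"
    using assms(3) h.hom_int_pow by simp
  also have "\<dots> = 0"
    using assms(5) h.hom_one by simp
  finally have "d * h g = 0" .
  moreover have "h g \<noteq> 0"
  proof
    assume "h g = 0"
    then have "g = \<one>\<^bsub>G\<^esub>"
      using h assms(3) h.hom_one by (auto simp: iso_def bij_betw_def inj_on_def)
    then have "trivial_group G"
      using assms(4) trivial_group_subgroup_generated[of "{g}"] by simp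
    then have "trivial_group integer_group"
      using isomorphic_group_triviality[OF assms(2)] by simp
    then show False by simp
  qed
  ultimately show ?thesis by simp
qed

text \<open>The boundary map is injective because \<open>H\<^sub>p(\<real>\<^sup>n)\<close> is trivial. A map into \<open>\<real>\<^sup>n - {0}\<close> that
  extends to \<open>\<real>\<^sup>n\<close> kills boundaries, as these die in \<open>\<real>\<^sup>n\<close>.\<close>

lemma hom_induced_punctured_trivial:
  fixes f g :: "'a::euclidean_space \<Rightarrow> 'a"
  assumes f: "continuous_on UNIV f" "\<And>x. f x = 0 \<Longrightarrow> x = 0"
    and g: "continuous_on UNIV g" "\<And>x. g x \<noteq> 0"
    and hom: "homotopic_with_canon (\<lambda>_. True) (- {0}) (- {0}) f g"
    and c: "c \<in> carrier (relative_homology_group p euclidean (- {0}))"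
  shows "hom_induced p euclidean (- {0}) euclidean (- {0}) f c
    = \<one>\<^bsub>relative_homology_group p euclidean (- {0})\<^esub>"
proof -
  let ?X = "euclidean :: 'a topology" and ?S = "- {0::'a}"
  let ?H = "relative_homology_group p ?X ?S" and ?K = "homology_group (p - 1) (top_of_set ?S)"
  let ?b = "hom_boundary p ?X ?S" and ?f = "hom_induced p ?X ?S ?X ?S f"
  interpret b: group_hom ?H ?K ?b
    by (auto simp: group_hom_def group_hom_axioms_def hom_boundary_hom)
  interpret g: group_hom "homology_group (p - 1) ?X" ?K "hom_induced (p - 1) ?X {} (top_of_set ?S) {} g"
    by (auto simp: group_hom_def group_hom_axioms_def hom_induced_hom)
  have gcont: "continuous_map ?X (top_of_set ?S) g"
    using g by (auto simp: continuous_map_in_subtopology)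
  have "?b (?f c) = hom_induced (p - 1) (top_of_set ?S) {} (top_of_set ?S) {} f (?b c)"
    using naturality_hom_induced[of ?X ?X f ?S ?S p] f by (auto simp: fun_eq_iff)
  \<comment> \<open>Here \<open>id\<close> is the inclusion into the whole space, on which
    \<open>g\<close> is still zero-free.\<close>
  also have "\<dots> = hom_induced (p - 1) (top_of_set ?S) {} (top_of_set ?S) {} (g \<circ> id) (?b c)"
    using homology_homotopy_empty[OF hom] by simp
  also have "\<dots> = hom_induced (p - 1) ?X {} (top_of_set ?S) {} g
      (hom_induced (p - 1) (top_of_set ?S) {} ?X {} id (?b c))"
    using gcont by (subst hom_induced_compose_empty[of _ ?X]) auto
  also have "hom_induced (p - 1) (top_of_set ?S) {} ?X {} id (?b c) = \<one>\<^bsub>homology_group (p - 1) ?X\<^esub>"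
    using homology_exactness_axiom_2[of p ?X ?S] c by (auto simp: kernel_def)
  finally have "?b (?f c) = ?b \<one>\<^bsub>?H\<^esub>"
    by simp
  moreover have "inj_on ?b (carrier ?H)"
    using iso_hom_boundary_punctured[of p, where 'a='a] by (auto simp: iso_def bij_betw_def)
  ultimately show ?thesis
    by (auto simp: inj_on_def hom_induced_carrier)
qed

text \<open>The excised set is the complement of \<open>U\<close>: it is closed and lies in the open
  set \<open>- {0}\<close>, because \<open>0 \<in> U\<close>.\<close>

lemma excision_punctured:
  fixes U :: "'a::euclidean_space set"
  assumes "open U" "0 \<in> U"
  shows "hom_induced p (top_of_set U) (U - {0}) euclidean (- {0}) id
    \<in> iso (relative_homology_group p (top_of_set U) (U - {0}))
          (relative_homology_group p euclidean (- {0}))"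
proof -
  have "U \<inter> - {0} = U - {0}" by blast
  moreover have "- {0} - - U = U - {0}" by blast
  ultimately show ?thesis
    using homology_excision_axiom[of euclidean "- U" "- {0}" UNIV p] assms
    by (simp add: closure_closed interior_open closed_Compl open_Compl)
qed


section \<open>Vanishing of the local degree\<close>

text \<open>Since \<open>f\<close> induces the trivial map, the condition on \<open>d\<close> says
  that the \<open>d\<close>-th power of the restricted generator is the identity. That class has
  infinite order.\<close>

lemma brouwer_degree_eq_0:
  fixes f g :: "real^'n::finite \<Rightarrow> real^'n"
  assumes f: "continuous_on UNIV f" "\<And>x. f x = 0 \<longleftrightarrow> x = 0"
    and g: "continuous_on UNIV g" "\<And>x. g x \<noteq> 0"
    and hom: "homotopic_with_canon (\<lambda>_. True) (- {0}) (- {0}) f g"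
    and U: "open U" "0 \<in> U"
  shows "brouwer_degree f U 0 = 0"
proof -
  let ?X = "euclidean :: (real^'n) topology" and ?n = "int CARD('n)"
  let ?H = "\<lambda>r. relative_homology_group ?n ?X (- cball 0 r)"
  let ?G = "relative_homology_group ?n ?X (- {0})"
  let ?HU = "relative_homology_group ?n (top_of_set U) (U - {0})"
  let ?i = "hom_induced ?n (top_of_set U) (U - {0}) ?X (- {0}) id"
  let ?j = "\<lambda>r. hom_induced ?n ?X (- cball 0 r) ?X (- {0}) id"
  \<comment> \<open>Fibre and value coincide, so one restriction map \<open>?j\<close> serves for
    both in the definition.\<close>
  have K: "{x \<in> U. f x = 0} = {0}"
    using f U by auto
  have iso: "?H r \<cong> integer_group" if "0 \<le> r" for r
    using relative_homology_group_complement_cball[OF that, where 'a="real^'n"] by simp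
  have f_trivial: "hom_induced ?n (top_of_set U) (U - {0}) ?X (- {0}) f c = \<one>\<^bsub>?G\<^esub>" for c
  proof -
    have "hom_induced ?n (top_of_set U) (U - {0}) ?X (- {0}) (f \<circ> id) c
      = hom_induced ?n ?X (- {0}) ?X (- {0}) f (?i c)"
      using f by (subst hom_induced_compose[of _ ?X _ _ "- {0}"]) (auto simp: continuous_map_in_subtopology)
    also have "\<dots> = \<one>\<^bsub>?G\<^esub>"
      using f g hom by (intro hom_induced_punctured_trivial) (auto simp: hom_induced_carrier)
    finally show ?thesis by simp
  qed
  show ?thesis
    unfolding brouwer_degree_def Let_def K f_trivial
  proof (rule the_equality, goal_cases)
    case 1
    \<comment> \<open>Existence: radius 0 suffices, as the ball only has to contain the origin;
      excision then supplies \<open>c\<close>.\<close>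
    have "cyclic_group (?H 0)"
      using iso[of 0] isomorphic_group_cyclicity by fastforce
    then obtain g where g: "g \<in> carrier (?H 0)" "subgroup_generated (?H 0) {g} = ?H 0"
      by (auto simp: cyclic_group_def)
    have "?j 0 g \<in> carrier ?G"
      by (rule hom_induced_carrier)
    with excision_punctured[OF U] obtain c where c: "c \<in> carrier ?HU" "?i c = ?j 0 g"
      by (rule iso_preimage)
    have pow: "\<one>\<^bsub>?G\<^esub> = ?j 0 g [^]\<^bsub>?G\<^esub> (0::int)"
      by simp
    show ?case
      by (rule exI[of _ 0], rule exI[of _ g], rule exI[of _ c])
        (intro conjI g c pow, simp)
  next
    case (2 d)
    then obtain r g where r: "0 \<in> cball (0::real^'n) r" and g: "g \<in> carrier (?H r)"
      and gen: "subgroup_generated (?H r) {g} = ?H r"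
      and pow: "\<one>\<^bsub>?G\<^esub> = ?j r g [^]\<^bsub>?G\<^esub> d"
      by auto
    have "0 \<le> r" using r by simp
    interpret j: group_hom "?H r" ?G "?j r"
      by (auto simp: group_hom_def group_hom_axioms_def hom_induced_hom)
    \<comment> \<open>Uniqueness, for any radius: injectivity of \<open>?j r\<close> transfers the
      relation at the origin to the generator.\<close>
    have "?j r (g [^]\<^bsub>?H r\<^esub> d) = ?j r \<one>\<^bsub>?H r\<^esub>"
      using pow j.hom_int_pow[OF g] j.hom_one by simp
    then have "g [^]\<^bsub>?H r\<^esub> d = \<one>\<^bsub>?H r\<^esub>"
      using inj_on_hom_induced_complement_cball[OF \<open>0 \<le> r\<close>, of ?n, where 'a="real^'n"] g
      by (meson inj_onD j.G.int_pow_closed j.G.one_closed)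
    then show "d = 0"
      using generator_int_pow_eq_one[OF _ iso[OF \<open>0 \<le> r\<close>] g gen] by simp
  qed
qed

lemma local_degree_eq_0:
  fixes f g :: "real^'n::finite \<Rightarrow> real^'n"
  assumes f: "continuous_on UNIV f" "\<And>x. f x = 0 \<longleftrightarrow> x = 0"
    and g: "continuous_on UNIV g" "\<And>x. g x \<noteq> 0"
    and hom: "homotopic_with_canon (\<lambda>_. True) (- {0}) (- {0}) f g"
  shows "local_degree f 0 = 0"
  unfolding local_degree_def
proof (rule the_equality)
  have f0: "f 0 = 0" using f by blast
  show "\<forall>U. open U \<and> bounded U \<and> 0 \<in> U \<and> (\<forall>x\<in>closure U. f x = f 0 \<longrightarrow> x = 0)
    \<longrightarrow> brouwer_degree f U (f 0) = 0"
    using brouwer_degree_eq_0[OF assms] f0 by simp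
  \<comment> \<open>The unit ball is an admissible neighbourhood; without one, every
    \<open>d\<close> would satisfy the condition vacuously.\<close>
  show "d = 0" if "\<forall>U. open U \<and> bounded U \<and> 0 \<in> U \<and> (\<forall>x\<in>closure U. f x = f 0 \<longrightarrow> x = 0)
    \<longrightarrow> brouwer_degree f U (f 0) = d" for d
    using that[rule_format, of "ball 0 1"] brouwer_degree_eq_0[OF assms, of "ball 0 1"] f f0 by simp
qed

text \<open>Intermediate maps may vanish inside the ball of radius \<open>R\<close>, so they are
  precomposed with the push, which avoids it. At the two ends the push is undone by its homotopy to
  the identity.\<close>

lemma homotopic_punctured:
  fixes h :: "real \<Rightarrow> 'a::real_normed_vector \<Rightarrow> 'a"
  assumes cont: "continuous_on ({0..1} \<times> UNIV) (\<lambda>(t, x). h t x)"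
    and R: "0 \<le> R" "\<And>t x. 0 \<le> t \<Longrightarrow> t \<le> 1 \<Longrightarrow> R < norm x \<Longrightarrow> h t x \<noteq> 0"
    and h0: "\<And>x. h 0 x = 0 \<Longrightarrow> x = 0" and h1: "\<And>x. h 1 x = 0 \<Longrightarrow> x = 0"
  shows "homotopic_with_canon (\<lambda>_. True) (- {0}) (- {0}) (h 0) (h 1)"
proof -
  let ?push = "\<lambda>x::'a. (1 + R / norm x) *\<^sub>R x"
  have push: "homotopic_with_canon (\<lambda>_. True) (- {0}) (- {0}) ?push id"
    using R by (intro homotopic_push_id) auto
  have cont_h: "continuous_on UNIV (h t)" if "0 \<le> t" "t \<le> 1" for t
    using continuous_on_compose2[OF cont, of UNIV "\<lambda>x. (t, x)"] that
    by (auto simp: continuous_on_Pair image_subset_iff)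
  have end_homotopy: "homotopic_with_canon (\<lambda>_. True) (- {0}) (- {0}) (h t \<circ> ?push) (h t)"
    if "0 \<le> t" "t \<le> 1" "\<And>x. h t x = 0 \<Longrightarrow> x = 0" for t
  proof -
    have "homotopic_with_canon (\<lambda>_. True) (- {0}) (- {0}) (h t \<circ> ?push) (h t \<circ> id)"
      using that continuous_on_subset[OF cont_h]
      by (intro homotopic_with_compose_continuous_left[where p="\<lambda>_. True", OF push]) auto
    then show ?thesis by simp
  qed
  have "homotopic_with_canon (\<lambda>_. True) (- {0}) (- {0}) (h 0 \<circ> ?push) (h 1 \<circ> ?push)"
  proof -
    have "continuous_on ({0..1} \<times> - {0}) (\<lambda>z. (fst z, ?push (snd z)))"
      by (auto intro!: continuous_intros)
    then have "continuous_on ({0..1} \<times> - {0}) (\<lambda>z. case (fst z, ?push (snd z)) of (t, x) \<Rightarrow> h t x)"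
      by (rule continuous_on_compose2[OF cont]) auto
    moreover have "h t (?push x) \<noteq> 0" if "0 \<le> t" "t \<le> 1" "x \<noteq> 0" for t x
      using that R norm_push[of x R] by (intro R(2)) auto
    then have "(\<lambda>z. h (fst z) (?push (snd z))) \<in> {0..1} \<times> - {0} \<rightarrow> - {0}"
      by fastforce
    ultimately show ?thesis
      unfolding homotopic_with_def prod_topology_subtopology_eu
      by (intro exI[of _ "\<lambda>z. h (fst z) (?push (snd z))"])
        (simp add: continuous_map_in_subtopology image_subset_iff_funcset)
  qed
  moreover have "homotopic_with_canon (\<lambda>_. True) (- {0}) (- {0}) (h 0) (h 0 \<circ> ?push)"
    using end_homotopy[of 0] h0 by (auto intro: homotopic_with_symD)
  moreover have "homotopic_with_canon (\<lambda>_. True) (- {0}) (- {0}) (h 1 \<circ> ?push) (h 1)"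
    using end_homotopy[of 1] h1 by auto
  ultimately show ?thesis
    by (meson homotopic_with_trans)
qed


section \<open>Polynomial complementarity problems\<close>

definition complementarity_map :: "(real^'n::finite \<Rightarrow> real^'n) \<Rightarrow> real^'n \<Rightarrow> real^'n" where
  "complementarity_map f x = (\<chi> i. min (x $ i) (f x $ i))"

lemma complementarity_map_nth [simp]:
  "complementarity_map f x $ i = min (x $ i) (f x $ i)"
  by (simp add: complementarity_map_def)

lemma tensor_min_map_eq: "tensor_min_map m A = complementarity_map (tensor_map m A)"
  by (auto simp: tensor_min_map_def complementarity_map_def)

lemma min_eq_0_iff: "min a b = 0 \<longleftrightarrow> 0 \<le> a \<and> 0 \<le> b \<and> a * b = 0" for a b :: real
  by (auto simp: min_def)

text \<open>For nonnegative vectors the inner product is a sum of nonnegative terms, so it vanishes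
  exactly when every term does.\<close>

lemma complementarity_map_eq_0_iff:
  "complementarity_map (\<lambda>x. f x + q) x = 0 \<longleftrightarrow> x \<in> SOL f q"
proof -
  have "x \<bullet> (f x + q) = 0 \<longleftrightarrow> (\<forall>i. x $ i * (f x + q) $ i = 0)" if "0 \<le> x" "0 \<le> f x + q"
    using that unfolding inner_vec_def less_eq_vec_def
    by (subst sum_nonneg_eq_0_iff) auto
  then show ?thesis
    unfolding SOL_def vec_eq_iff complementarity_map_nth
    by (auto simp: min_eq_0_iff less_eq_vec_def)
qed

lemma continuous_on_complementarity_map:
  assumes "continuous_on UNIV f"
  shows "continuous_on UNIV (complementarity_map f)"
  unfolding complementarity_map_def using assms
  by (intro continuous_on_vec_lambda continuous_on_min continuous_on_component continuous_on_id)

text \<open>In each component, the minimum with the fixed number \<open>x $ i\<close> is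
  nonexpansive in its second argument.\<close>

lemma norm_complementarity_map_diff_le:
  "norm (complementarity_map f x - complementarity_map g x) \<le> norm (f x - g x)"
  by (rule norm_le_componentwise_cart) (auto simp: min_def)

section \<open>Continuity, homogeneity and growth\<close>

lemma continuous_on_prod_list:
  fixes f :: "'b \<Rightarrow> 'a::topological_space \<Rightarrow> real"
  assumes "\<And>j. j \<in> set js \<Longrightarrow> continuous_on S (f j)"
  shows "continuous_on S (\<lambda>x. prod_list (map (\<lambda>j. f j x) js))"
  using assms by (induction js) (auto intro!: continuous_intros)

lemma continuous_on_tensor_map: "continuous_on S (tensor_map m A)"
  unfolding tensor_map_def[abs_def]
  by (intro continuous_on_vec_lambda continuous_intros continuous_on_prod_list)

lemma tensor_map_scaleR: "tensor_map m A (s *\<^sub>R x) = s ^ (m - 1) *\<^sub>R tensor_map m A x"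
proof -
  have "prod_list (map (\<lambda>j. (s *\<^sub>R x) $ j) js) = s ^ length js * prod_list (map (\<lambda>j. x $ j) js)" for js
    by (induction js) auto
  then show ?thesis
    by (auto simp: vec_eq_iff tensor_map_def sum_distrib_left mult_ac intro!: sum.cong)
qed

lemma polynomial_map_continuous_on:
  assumes "polynomial_map_degree_less k P"
  shows "continuous_on S P"
proof -
  obtain c where "P = (\<lambda>x. \<Sum>\<alpha> | sum \<alpha> UNIV < k. (\<Prod>i\<in>UNIV. (x $ i) ^ \<alpha> i) *\<^sub>R c \<alpha>)"
    using assms by (auto simp: polynomial_map_degree_less_def)
  then show ?thesis
    by (auto intro!: continuous_intros)
qed

text \<open>Where \<open>norm x \<ge> 1\<close>, the highest power dominates each monomial; the
  constant is the sum of the coefficient norms.\<close>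

lemma polynomial_map_growth:
  fixes P :: "real^'n::finite \<Rightarrow> real^'n"
  assumes "polynomial_map_degree_less k P"
  obtains C where "0 \<le> C" "\<And>x. 1 \<le> norm x \<Longrightarrow> norm (P x) \<le> C * norm x ^ (k - 1)"
proof -
  obtain c where c: "\<And>x. P x = (\<Sum>\<alpha> | sum \<alpha> UNIV < k. (\<Prod>i\<in>UNIV. (x $ i) ^ \<alpha> i) *\<^sub>R c \<alpha>)"
    using assms by (auto simp: polynomial_map_degree_less_def)
  show thesis
  proof
    show "0 \<le> (\<Sum>\<alpha> | sum \<alpha> UNIV < k. norm (c \<alpha>))"
      by (simp add: sum_nonneg)
    fix x :: "real^'n" assume x: "1 \<le> norm x"
    have "norm (P x) \<le> (\<Sum>\<alpha> | sum \<alpha> UNIV < k. norm (c \<alpha>) * norm x ^ (k - 1))"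
      unfolding c
    proof (rule sum_norm_le)
      fix \<alpha> :: "'n \<Rightarrow> nat" assume "\<alpha> \<in> {\<alpha>. sum \<alpha> UNIV < k}"
      then have \<alpha>: "sum \<alpha> UNIV \<le> k - 1" by simp
      have "norm (\<Prod>i\<in>UNIV. (x $ i) ^ \<alpha> i) = (\<Prod>i\<in>UNIV. \<bar>x $ i\<bar> ^ \<alpha> i)"
        by (simp add: abs_prod power_abs)
      also have "\<dots> \<le> (\<Prod>i\<in>UNIV. norm x ^ \<alpha> i)"
        by (intro prod_mono conjI power_mono component_le_norm_cart) auto
      also have "\<dots> = norm x ^ sum \<alpha> UNIV"
        by (simp add: power_sum)
      also have "\<dots> \<le> norm x ^ (k - 1)"
        using \<alpha> x by (rule power_increasing)
      finally have "norm (\<Prod>i\<in>UNIV. (x $ i) ^ \<alpha> i) * norm (c \<alpha>) \<le> norm x ^ (k - 1) * norm (c \<alpha>)"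
        by (rule mult_right_mono) simp
      then show "norm ((\<Prod>i\<in>UNIV. (x $ i) ^ \<alpha> i) *\<^sub>R c \<alpha>) \<le> norm (c \<alpha>) * norm x ^ (k - 1)"
        by (simp add: mult.commute)
    qed
    then show "norm (P x) \<le> (\<Sum>\<alpha> | sum \<alpha> UNIV < k. norm (c \<alpha>)) * norm x ^ (k - 1)"
      by (simp add: sum_distrib_right)
  qed
qed

lemma R0_tensor_zero_iff:
  assumes "R0_tensor m A"
  shows "complementarity_map (tensor_map m A) x = 0 \<longleftrightarrow> x = 0"
  using assms complementarity_map_eq_0_iff[of "tensor_map m A" 0 x]
  by (simp add: R0_tensor_def)

text \<open>Rescaling \<open>x\<close> to the unit sphere multiplies the two arguments of each minimum by the different
  positive factors \<open>1 / norm x\<close> and \<open>1 / norm x ^ (m - 1)\<close>, which preserves zeros.\<close>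

lemma R0_tensor_zeros_bounded:
  fixes A :: "'n::finite tensor" and Q :: "real^'n \<Rightarrow> real^'n"
  assumes m: "m \<ge> 2" and R0: "R0_tensor m A"
    and C: "0 \<le> C" "\<And>x. 1 \<le> norm x \<Longrightarrow> norm (Q x) \<le> C * norm x ^ (m - 2)"
  obtains R where "0 \<le> R" "\<And>t x. 0 \<le> t \<Longrightarrow> t \<le> 1 \<Longrightarrow> R < norm x \<Longrightarrow>
    complementarity_map (\<lambda>x. tensor_map m A x + t *\<^sub>R Q x) x \<noteq> 0"
proof -
  let ?F = "tensor_map m A"
  have "continuous_on (sphere 0 1) (\<lambda>y. norm (complementarity_map ?F y))"
    using continuous_on_complementarity_map[OF continuous_on_tensor_map]
    by (intro continuous_on_norm) (rule continuous_on_subset, auto)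
  then obtain y0 where y0: "y0 \<in> sphere 0 1"
    and min: "\<And>y. y \<in> sphere 0 1 \<Longrightarrow> norm (complementarity_map ?F y0) \<le> norm (complementarity_map ?F y)"
    using continuous_attains_inf[of "sphere (0::real^'n) 1" "\<lambda>y. norm (complementarity_map ?F y)"]
    by (auto simp: compact_sphere)
  \<comment> \<open>The minimum over the unit sphere is positive by the R0-property, as
    \<open>y0\<close> is not zero.\<close>
  define \<delta> where "\<delta> = norm (complementarity_map ?F y0)"
  have "\<delta> > 0"
    using y0 R0_tensor_zero_iff[OF R0, of y0] by (auto simp: \<delta>_def)
  show thesis
  proof
    \<comment> \<open>The 1 makes the growth estimate of \<open>Q\<close> applicable;
      \<open>C / \<delta>\<close> contradicts the final \<open>\<delta> \<le> C / s\<close>.\<close>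
    show "0 \<le> max 1 (C / \<delta>)" by simp
    fix t :: real and x :: "real^'n"
    assume t: "0 \<le> t" "t \<le> 1" and x: "max 1 (C / \<delta>) < norm x"
    show "complementarity_map (\<lambda>x. ?F x + t *\<^sub>R Q x) x \<noteq> 0"
    proof
      assume zero: "complementarity_map (\<lambda>x. ?F x + t *\<^sub>R Q x) x = 0"
      define s where "s = norm x"
      have s: "1 < s" "C / \<delta> < s" using x by (auto simp: s_def)
      define y where "y = (1 / s) *\<^sub>R x"
      \<comment> \<open>The perturbation divided by the homogeneity factor of
        \<open>?F\<close>.\<close>
      define e where "e = (t / s ^ (m - 1)) *\<^sub>R Q x"
      have "complementarity_map (\<lambda>y. ?F y + e) y = 0"
      proof (rule vec_eq_iff[THEN iffD2], rule allI)
        fix i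
        have "min (x $ i) ((?F x + t *\<^sub>R Q x) $ i) = 0"
          using zero by (metis complementarity_map_nth zero_index)
        moreover have "(?F y + e) $ i = (?F x + t *\<^sub>R Q x) $ i / s ^ (m - 1)"
          by (simp add: y_def e_def tensor_map_scaleR power_divide add_divide_distrib)
        moreover have "min (a / s) (b / s ^ (m - 1)) = 0" if "min a b = 0" for a b
          using that s by (auto simp: min_eq_0_iff)
        ultimately show "complementarity_map (\<lambda>y. ?F y + e) y $ i = 0 $ i"
          by (simp add: y_def)
      qed
      \<comment> \<open>The perturbed map vanishes at \<open>y\<close>, so the unperturbed value is
        no larger than the perturbation.\<close>
      then have "norm (complementarity_map ?F y) \<le> norm e"
        using norm_complementarity_map_diff_le[of ?F y "\<lambda>y. ?F y + e"] by simp
      also have "\<dots> = t * (norm (Q x) / s ^ (m - 1))"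
        using t s by (simp add: e_def)
      also have "\<dots> \<le> 1 * (C * s ^ (m - 2) / s ^ (m - 1))"
        using t s C(2)[of x] by (intro mult_mono divide_right_mono) (auto simp: s_def)
      \<comment> \<open>As \<open>m \<ge> 2\<close>, one power of \<open>s\<close> survives in the
        denominator: the gain from the lower degree of \<open>Q\<close>.\<close>
      also have "s ^ (m - 1) = s * s ^ (m - 2)"
        using m by (simp flip: power_Suc add: Suc_diff_Suc numeral_2_eq_2)
      finally have "norm (complementarity_map ?F y) \<le> C / s"
        using s by simp
      moreover have "y \<in> sphere 0 1"
        using s by (auto simp: y_def s_def)
      ultimately have "\<delta> \<le> C / s"
        using min unfolding \<delta>_def by fastforce
      then show False
        using s \<open>\<delta> > 0\<close> by (simp add: field_simps)
    qed
  qed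
qed

theorem theorem3p2:
  fixes A :: "'n::finite tensor" and m :: nat
  assumes "m \<ge> 2"
    and "R0_tensor m A"
    and "tensor_degree m A \<noteq> 0"
  shows "strong_Q_property m A"
  unfolding strong_Q_property_def
proof (intro allI impI)
  fix P :: "real^'n \<Rightarrow> real^'n" and q :: "real^'n"
  assume P: "polynomial_map_degree_less (m - 1) P"
  let ?F = "tensor_map m A" and ?Q = "\<lambda>x. P x + q"
  define h where "h = (\<lambda>t. complementarity_map (\<lambda>x. ?F x + t *\<^sub>R ?Q x))"
  have SOL: "SOL (\<lambda>x. ?F x + P x) q = {x. h 1 x = 0}"
    using complementarity_map_eq_0_iff[of "\<lambda>x. ?F x + P x" q] by (auto simp: h_def add.assoc)
  have h0: "h 0 x = 0 \<longleftrightarrow> x = 0" for x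
    using R0_tensor_zero_iff[OF assms(2)] by (simp add: h_def)
  note cont_P = polynomial_map_continuous_on[OF P]
  have cont_h: "continuous_on UNIV (h t)" for t
    unfolding h_def using cont_P
    by (intro continuous_on_complementarity_map continuous_intros continuous_on_tensor_map)
  obtain C where C: "0 \<le> C" "\<And>x. 1 \<le> norm x \<Longrightarrow> norm (P x) \<le> C * norm x ^ (m - 1 - 1)"
    using polynomial_map_growth[OF P] by metis
  have "norm (?Q x) \<le> (C + norm q) * norm x ^ (m - 2)" if "1 \<le> norm x" for x
  proof -
    have "norm (?Q x) \<le> C * norm x ^ (m - 2) + norm q"
      using norm_triangle_ineq[of "P x" q] C(2)[OF that] by (simp add: numeral_2_eq_2)
    \<comment> \<open>The constant is absorbed because
      \<open>norm x ^ (m - 2) \<ge> 1\<close>.\<close>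
    also have "norm q \<le> norm q * norm x ^ (m - 2)"
      using that by (simp add: mult_le_cancel_left1)
    finally show ?thesis
      by (simp add: algebra_simps)
  qed
  then obtain R where R: "0 \<le> R"
    "\<And>t x. 0 \<le> t \<Longrightarrow> t \<le> 1 \<Longrightarrow> R < norm x \<Longrightarrow> h t x \<noteq> 0"
    using R0_tensor_zeros_bounded[OF assms(1,2), of "C + norm q" ?Q] C(1) unfolding h_def
    by auto
  show "SOL (\<lambda>x. ?F x + P x) q \<noteq> {} \<and> compact (SOL (\<lambda>x. ?F x + P x) q)"
    unfolding SOL
  proof
    have "bounded {x. h 1 x = 0}"
      using R(2)[of 1] by (intro boundedI[of _ R]) (force simp: not_less[symmetric])
    moreover have "closed {x. h 1 x = 0}"
      using cont_h by (intro closed_Collect_eq) auto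
    ultimately show "compact {x. h 1 x = 0}"
      by (simp add: compact_eq_bounded_closed)
    show "{x. h 1 x = 0} \<noteq> {}"
    proof
      assume "{x. h 1 x = 0} = {}"
      then have h1: "h 1 x \<noteq> 0" for x by blast
      have "continuous_on ({0..1} \<times> UNIV) (\<lambda>(t, x). h t x)"
        unfolding h_def complementarity_map_def case_prod_beta
        by (intro continuous_on_vec_lambda continuous_on_min continuous_intros
            continuous_on_compose2[OF continuous_on_tensor_map]
            continuous_on_compose2[OF cont_P]) auto
      then have "homotopic_with_canon (\<lambda>_. True) (- {0}) (- {0}) (h 0) (h 1)"
        using R h0 h1 by (intro homotopic_punctured) auto
      \<comment> \<open>By assumption \<open>h 1\<close> has no zeros on the whole space, so it
        serves as the zero-free extension.\<close>
      then have "local_degree (h 0) 0 = 0"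
        using cont_h h0 h1 by (intro local_degree_eq_0)
      moreover have "h 0 = tensor_min_map m A"
        by (simp add: h_def tensor_min_map_eq)
      ultimately show False
        using assms(3) by (simp add: tensor_degree_def)
    qed
  qed
qed

end
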